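(* Let $\xi(t)$, $t\in\mathbb{Z}$, be a real-valued stationary random process with $\langle \xi(t)\rangle=0$ and $\langle \xi^2(t)\rangle=1$, with correlation function $b(t)=\langle \xi(t+t')\xi(t')\rangle$, and let $Q_N=(b(j-k))_{j,k=0}^{N-1}$, $N=1,2,\dots$. Then the process $\xi(t)$ is stable if and only if $$\lim_{N\to\infty}\frac{1}{N}\|Q_N\|_2=0,$$ where $\|Q_N\|_2$ is the Hilbert-Schmidt norm of $Q_N$.
   Context: $\langle\cdot\rangle$ denotes the mean (expectation); by stationarity $b(t)=\langle\xi(t+t')\xi(t')\rangle$ does not depend on $t'\in\mathbb{Z}$. The correlation function $b$ is a real-valued sequence admitting the representation $$b(t)=\int_{-\pi}^{\pi}e^{it\theta}\,d\sigma(\theta),\quad t\in\mathbb{Z},$$ where the spectral distribution function $\sigma$ is a non-decreasing bounded function on $[-\pi,\pi]$, with $b(0)=\sigma(\pi)-\sigma(-\pi)=1$ and $\sigma(\theta_2)-\sigma(\theta_1)=\sigma(-\theta_1)-\sigma(-\theta_2)$ for all $0\le\theta_1\le\theta_2\le\pi$. The process $\xi(t)$ is called stable if $\sigma$ is continuous on $[-\pi,\pi]$, and unstable otherwise. The Hilbert-Schmidt norm is $\|Q_N\|_2=\left(\sum_{j,k=0}^{N-1}b^2(j-k)\right)^{1/2}$. *)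

theory Defs
  imports "HOL-Probability.Probability" "Jordan_Normal_Form.Matrix"
begin

text \<open>Stationarity is understood in the wide sense: second moments exist, and the mean and the
  correlations are invariant under time shifts. A strictly stationary process with finite second
  moments is stationary in this sense.\<close>

definition stationary_process :: "'a measure \<Rightarrow> (int \<Rightarrow> 'a \<Rightarrow> real) \<Rightarrow> bool" where
  "stationary_process M \<xi> \<longleftrightarrow>
     prob_space M \<and>
     (\<forall>t. \<xi> t \<in> borel_measurable M \<and> integrable M (\<lambda>\<omega>. (\<xi> t \<omega>)\<^sup>2)) \<and>
     (\<forall>t s. prob_space.expectation M (\<xi> t) = prob_space.expectation M (\<xi> s)) \<and>
     (\<forall>t s s'. prob_space.expectation M (\<lambda>\<omega>. \<xi> (t + s) \<omega> * \<xi> s \<omega>) =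
               prob_space.expectation M (\<lambda>\<omega>. \<xi> (t + s') \<omega> * \<xi> s' \<omega>))"

text \<open>By stationarity the base point \<open>t' = 0\<close> below can be replaced by any other one.\<close>

definition correlation :: "'a measure \<Rightarrow> (int \<Rightarrow> 'a \<Rightarrow> real) \<Rightarrow> int \<Rightarrow> real" where
  "correlation M \<xi> t = prob_space.expectation M (\<lambda>\<omega>. \<xi> t \<omega> * \<xi> 0 \<omega>)"

text \<open>The Riemann--Stieltjes integral of \<open>f\<close> over \<open>[a, b]\<close> with respect to \<open>\<sigma>\<close>, as the
  limit of \<open>\<Sum> (\<sigma>(v) - \<sigma>(u)) f(x)\<close> over tagged partitions into intervals \<open>[u, v] \<ni> x\<close> as the
  mesh tends to 0. Jumps of \<open>\<sigma>\<close> at the end points \<open>a\<close> and \<open>b\<close> contribute. The function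
  \<open>\<sigma>\<close> need not be one-sided continuous, so \<open>interval_measure\<close> is not directly applicable.\<close>

definition has_RS_integral ::
    "(real \<Rightarrow> complex) \<Rightarrow> (real \<Rightarrow> real) \<Rightarrow> real \<Rightarrow> real \<Rightarrow> complex \<Rightarrow> bool" where
  "has_RS_integral f \<sigma> a b I \<longleftrightarrow>
     (\<forall>\<epsilon>>0. \<exists>\<delta>>0. \<forall>D. D tagged_division_of {a..b} \<and> (\<lambda>x. ball x \<delta>) fine D \<longrightarrow>
        norm ((\<Sum>(x, K)\<in>D. (\<sigma> (Sup K) - \<sigma> (Inf K)) *\<^sub>R f x) - I) < \<epsilon>)"

definition spectral_distribution :: "(int \<Rightarrow> real) \<Rightarrow> (real \<Rightarrow> real) \<Rightarrow> bool" where
  "spectral_distribution b \<sigma> \<longleftrightarrow>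
     mono_on {-pi..pi} \<sigma> \<and>
     bounded (\<sigma> ` {-pi..pi}) \<and>
     (\<forall>t. has_RS_integral (\<lambda>\<theta>. exp (\<i> * of_int t * of_real \<theta>)) \<sigma> (-pi) pi (of_real (b t))) \<and>
     b 0 = \<sigma> pi - \<sigma> (-pi) \<and> \<sigma> pi - \<sigma> (-pi) = 1 \<and>
     (\<forall>\<theta>1 \<theta>2. 0 \<le> \<theta>1 \<and> \<theta>1 \<le> \<theta>2 \<and> \<theta>2 \<le> pi \<longrightarrow>
        \<sigma> \<theta>2 - \<sigma> \<theta>1 = \<sigma> (-\<theta>1) - \<sigma> (-\<theta>2))"

text \<open>A spectral distribution function exists by Herglotz' theorem. It is determined by \<open>b\<close> up to
  an additive constant and the values at its interior discontinuities, so its continuity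
  does not depend on the choice of \<open>\<sigma>\<close>.\<close>

definition stable_process :: "'a measure \<Rightarrow> (int \<Rightarrow> 'a \<Rightarrow> real) \<Rightarrow> bool" where
  "stable_process M \<xi> \<longleftrightarrow>
     (\<exists>\<sigma>. spectral_distribution (correlation M \<xi>) \<sigma> \<and> continuous_on {-pi..pi} \<sigma>)"

definition correlation_mat :: "(int \<Rightarrow> real) \<Rightarrow> nat \<Rightarrow> real mat" where
  "correlation_mat b N = mat N N (\<lambda>(j, k). b (int j - int k))"

definition hilbert_schmidt_norm :: "real mat \<Rightarrow> real" where
  "hilbert_schmidt_norm A = sqrt (\<Sum>j<dim_row A. \<Sum>k<dim_col A. (A $$ (j, k))\<^sup>2)"

end

theory Submission
  imports Defs
begin

text \<open>Wiener's theorem on the atoms of a measure explains the equivalence. Let \<open>\<mu>\<close> be a probability measure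
  with Fourier coefficients \<open>b\<close>. Then
  \<open>(\<Sum>j<N. \<Sum>k<N. b (j - k) exp (i (j - k) a)) / N\<^sup>2\<close> is the \<open>\<mu>\<close>-integral of the squared modulus of
  the averaged Dirichlet kernel at \<open>x + a\<close>, and tends to the mass of \<open>-a + 2 \<pi> \<int>\<close>
  (\<open>toeplitz_form_tendsto\<close>). By Cauchy--Schwarz its modulus is at most \<open>\<parallel>Q\<^sub>N\<parallel>\<^sub>2 / N\<close>, so
  \<open>\<mu>\<close> has no atoms if this quotient tends to 0. Conversely, integrating the same expression over \<open>a\<close> with
  respect to \<open>\<mu>\<close> yields \<open>\<parallel>Q\<^sub>N\<parallel>\<^sub>2\<^sup>2 / N\<^sup>2\<close>, and if \<open>\<mu>\<close> has no atoms, then dominated convergence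
  makes the integral tend to 0.

  It remains to pass between the measure \<open>\<mu>\<close> and spectral distribution functions. A continuous spectral
  distribution function is, on \<open>[-\<pi>, \<pi>]\<close> and up to an additive constant, the distribution function of an atomless
  measure, and its Riemann--Stieltjes integrals are integrals with respect to that measure
  (\<open>has_RS_integral_cdf\<close>, \<open>has_RS_integral_unique\<close>). In the other direction the measure must be
  constructed from \<open>b\<close> alone. This is Herglotz' theorem (\<open>herglotz\<close>): the Cesaro means of the
  Fourier series of \<open>b\<close> are nonnegative densities on \<open>[-\<pi>, \<pi>]\<close>, and a weak limit of the
  measures that they define has the Fourier coefficients \<open>b\<close>. The densities are even, which
  gives the symmetry required of a spectral distribution function.\<close>

section \<open>Wiener's theorem and the Hilbert--Schmidt norm\<close>

text \<open>The averaged Dirichlet kernel detects the points congruent to 0 modulo \<open>2 \<pi>\<close>: elsewhere the geometric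
  sum stays bounded in \<open>N\<close>, so dividing it by \<open>N\<close> kills it.\<close>

lemma cesaro_mean_iexp:
  "(\<lambda>N. (\<Sum>j<N. iexp (real j * z)) / of_nat N) \<longlonglongrightarrow> (if iexp z = 1 then 1 else 0)"
proof (cases "iexp z = 1")
  case True
  have "iexp (real j * z) = 1" for j
    using True by (metis exp_of_nat_mult mult.left_commute of_real_mult of_real_of_nat_eq power_one)
  then have "eventually (\<lambda>N. (\<Sum>j<N. iexp (real j * z)) / of_nat N = 1) sequentially"
    by (intro eventually_sequentiallyI[of 1]) simp
  then show ?thesis using True by (simp add: tendsto_eventually)
next
  case False
  have geo: "(\<Sum>j<N. iexp (real j * z)) = (1 - iexp z ^ N) / (1 - iexp z)" for N
  proof -
    have "iexp (real j * z) = iexp z ^ j" for j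
      by (metis exp_of_nat_mult mult.left_commute of_real_mult of_real_of_nat_eq)
    then show ?thesis using False by (simp add: sum_gp_strict)
  qed
  have "(\<lambda>N. (2 / cmod (1 - iexp z)) / real N) \<longlonglongrightarrow> 0"
    by (rule lim_const_over_n)
  moreover have "cmod ((\<Sum>j<N. iexp (real j * z)) / of_nat N)
      \<le> (2 / cmod (1 - iexp z)) / real N" for N
  proof -
    have "cmod (1 - iexp z ^ N) \<le> 2"
      using norm_triangle_ineq4[of 1 "iexp z ^ N"] by (simp add: norm_power)
    then show ?thesis
      unfolding geo by (simp add: norm_divide norm_mult divide_right_mono)
  qed
  ultimately have "(\<lambda>N. (\<Sum>j<N. iexp (real j * z)) / of_nat N) \<longlonglongrightarrow> 0"
    by (intro Lim_null_comparison[where f = "\<lambda>N. (\<Sum>j<N. iexp (real j * z)) / of_nat N"]) auto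
  then show ?thesis using False by simp
qed

lemma cesaro_mean_iexp_le_1: "cmod ((\<Sum>j<N. iexp (real j * z)) / of_nat N) \<le> 1"
proof -
  have "cmod (\<Sum>j<N. iexp (real j * z)) \<le> (\<Sum>j<N. 1)"
    by (rule sum_norm_le) simp
  then show ?thesis by (simp add: norm_divide divide_le_eq)
qed

text \<open>The quadratic form of the correlation matrix on the vector \<open>(exp (- i j a))\<^sub>j\<close>. Averaging it over \<open>a\<close> with
  respect to the spectral measure gives the squared Hilbert--Schmidt norm, and its limit after
  division by \<open>N\<^sup>2\<close> is the spectral mass at \<open>-a\<close> modulo \<open>2 \<pi>\<close>; it therefore links the norm with the atoms.\<close>

definition toeplitz_form :: "(int \<Rightarrow> real) \<Rightarrow> nat \<Rightarrow> real \<Rightarrow> complex" where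
  "toeplitz_form b N a =
     (\<Sum>j<N. \<Sum>k<N. of_real (b (int j - int k)) * iexp ((real j - real k) * a))"

lemma norm_square_exponential_sum:
  "of_real ((cmod (\<Sum>j<N. iexp (real j * z)))\<^sup>2) =
     (\<Sum>j<N. \<Sum>k<N. iexp ((real j - real k) * z))"
proof -
  have "iexp (real j * z) * cnj (iexp (real k * z)) = iexp ((real j - real k) * z)" for j k
    by (simp add: exp_cnj algebra_simps flip: exp_add)
  then show ?thesis
    by (simp only: complex_norm_square cnj_sum sum_product)
qed

lemma norm_square_cesaro_mean:
  "of_real ((cmod ((\<Sum>j<N. iexp (real j * z)) / of_nat N))\<^sup>2) =
     (\<Sum>j<N. \<Sum>k<N. iexp ((real j - real k) * z)) / of_nat N ^ 2"
  unfolding norm_square_exponential_sum[symmetric]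
  by (simp only: norm_divide power_divide norm_of_nat of_real_divide of_real_power of_real_of_nat_eq)

context real_distribution
begin

lemma integrable_iexp_affine: "integrable M (\<lambda>x. iexp (c * (x + a)))"
  by (rule integrable_iexp) auto

lemma char_shift: "(CLINT x|M. iexp (c * (x + a))) = iexp (c * a) * char M c"
proof -
  have "iexp (c * (x + a)) = iexp (c * a) * iexp (c * x)" for x
    by (simp add: algebra_simps flip: exp_add)
  then show ?thesis by (simp add: char_def)
qed

text \<open>The coefficients \<open>b (j - k)\<close> are Fourier coefficients of \<open>M\<close>, so summing under the integral sign
  produces the squared modulus of the averaged Dirichlet kernel.\<close>

lemma toeplitz_form_eq_integral:
  assumes char: "\<And>t. char M (of_int t) = of_real (b t)"
  shows "toeplitz_form b N a / of_nat N ^ 2 =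
     (CLINT x|M. of_real ((cmod ((\<Sum>j<N. iexp (real j * (x + a))) / of_nat N))\<^sup>2))"
proof -
  have c: "char M (real j - real k) = of_real (b (int j - int k))" for j k
    using char[of "int j - int k"] by simp
  show ?thesis
    unfolding norm_square_cesaro_mean toeplitz_form_def
    by (simp add: integrable_iexp_affine char_shift c mult.commute[of "of_real (b _)"]
          del: of_real_add of_real_mult of_real_diff)
qed

lemma toeplitz_form_norm_le:
  assumes char: "\<And>t. char M (of_int t) = of_real (b t)"
  shows "cmod (toeplitz_form b N a / of_nat N ^ 2) \<le> 1"
proof -
  have "cmod (toeplitz_form b N a / of_nat N ^ 2) \<le>
     (LINT x|M. cmod (of_real ((cmod ((\<Sum>j<N. iexp (real j * (x + a))) / of_nat N))\<^sup>2)))"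
    unfolding toeplitz_form_eq_integral[OF char] by (rule integral_norm_bound)
  also have "\<dots> \<le> (LINT x|M. 1)"
    using cesaro_mean_iexp_le_1
    by (intro integral_mono' ) (auto simp: norm_power power_le_one simp del: of_real_add of_real_mult)
  finally show ?thesis by (simp add: prob_space del: space_eq_univ)
qed

text \<open>Wiener's theorem for a single frequency. The integrand of the preceding representation is bounded by 1
  and tends to the indicator of \<open>-a + 2 \<pi> \<int>\<close>, so dominated convergence applies.\<close>

theorem toeplitz_form_tendsto:
  assumes char: "\<And>t. char M (of_int t) = of_real (b t)"
  shows "(\<lambda>N. toeplitz_form b N a / of_nat N ^ 2) \<longlonglongrightarrow> of_real (measure M {x. iexp (x + a) = 1})"
proof -
  have [measurable]: "{x. iexp (x + a) = 1} \<in> sets borel" by measurable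
  have "(\<lambda>N. toeplitz_form b N a / of_nat N ^ 2) \<longlonglongrightarrow>
      (CLINT x|M. of_real (indicator {x. iexp (x + a) = 1} x))"
    unfolding toeplitz_form_eq_integral[OF char]
  proof (rule integral_dominated_convergence[where w = "\<lambda>_. 1"])
    show "AE x in M. (\<lambda>N. complex_of_real ((cmod ((\<Sum>j<N. iexp (real j * (x + a))) / of_nat N))\<^sup>2))
        \<longlonglongrightarrow> of_real (indicator {x. iexp (x + a) = 1} x)"
    proof (rule AE_I2)
      fix x
      show "(\<lambda>N. complex_of_real ((cmod ((\<Sum>j<N. iexp (real j * (x + a))) / of_nat N))\<^sup>2))
        \<longlonglongrightarrow> of_real (indicator {x. iexp (x + a) = 1} x)"
        by (rule tendsto_eq_rhs[OF tendsto_of_real[OF tendsto_power[OF tendsto_norm[OF cesaro_mean_iexp]]]])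
           (auto simp: indicator_def)
    qed
    show "AE x in M. norm (complex_of_real ((cmod ((\<Sum>j<N. iexp (real j * (x + a))) / of_nat N))\<^sup>2)) \<le> 1" for N
      using cesaro_mean_iexp_le_1
      by (intro AE_I2) (simp add: norm_power power_le_one del: of_real_add of_real_mult)
  qed (auto simp: prob_space)
  then show ?thesis by (simp del: of_real_add)
qed

end

text \<open>Cauchy--Schwarz over the \<open>N\<^sup>2\<close> matrix entries, since all exponentials have modulus 1.\<close>

lemma toeplitz_form_abs_le_hilbert_schmidt:
  "cmod (toeplitz_form b N a) \<le> real N * hilbert_schmidt_norm (correlation_mat b N)"
proof -
  have "cmod (toeplitz_form b N a) \<le> (\<Sum>j<N. \<Sum>k<N. \<bar>b (int j - int k)\<bar>)"
    unfolding toeplitz_form_def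
    by (intro sum_norm_le) (auto simp: norm_mult simp del: of_real_mult of_real_diff intro!: sum_norm_le)
  also have "\<dots> = (\<Sum>p\<in>{..<N}\<times>{..<N}. \<bar>1\<bar> * \<bar>case p of (j,k) \<Rightarrow> b (int j - int k)\<bar>)"
    by (simp add: sum.cartesian_product case_prod_unfold)
  also have "\<dots> \<le> L2_set (\<lambda>_. 1) ({..<N}\<times>{..<N}) *
      L2_set (\<lambda>p. case p of (j,k) \<Rightarrow> b (int j - int k)) ({..<N}\<times>{..<N})"
    by (rule L2_set_mult_ineq)
  also have "\<dots> = real N * hilbert_schmidt_norm (correlation_mat b N)"
    unfolding L2_set_def hilbert_schmidt_norm_def correlation_mat_def
    by (simp add: sum.cartesian_product case_prod_unfold)
  finally show ?thesis .
qed

text \<open>An atom at \<open>a\<close> bounds the limit of the normalised Toeplitz form at \<open>-a\<close> from below, whereas the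
  Hilbert--Schmidt norm bounds the form from above.\<close>

lemma hilbert_schmidt_norm_tendsto_imp_atomless:
  assumes "real_distribution M" and char: "\<And>t. char M (of_int t) = of_real (b t)"
    and lim: "(\<lambda>N. hilbert_schmidt_norm (correlation_mat b N) / real N) \<longlonglongrightarrow> 0"
  shows "measure M {a} = 0"
proof -
  interpret real_distribution M by fact
  have "cmod (toeplitz_form b N (-a) / of_nat N ^ 2) \<le> hilbert_schmidt_norm (correlation_mat b N) / real N" for N
    using toeplitz_form_abs_le_hilbert_schmidt[of b N "-a"]
    by (cases "N = 0") (simp_all add: norm_divide norm_power divide_le_eq, simp add: power2_eq_square mult_ac)
  then have "(\<lambda>N. toeplitz_form b N (-a) / of_nat N ^ 2) \<longlonglongrightarrow> 0"
    by (intro Lim_null_comparison[OF _ lim]) auto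
  from LIMSEQ_unique[OF toeplitz_form_tendsto[OF char] this]
  have "measure M {x. iexp (x + - a) = 1} = 0"
    unfolding of_real_eq_0_iff .
  moreover have "measure M {a} \<le> measure M {x. iexp (x + - a) = 1}"
    by (rule finite_measure_mono) auto
  ultimately show ?thesis using measure_nonneg[of M "{a}"] by linarith
qed

text \<open>Integrating the Toeplitz form against \<open>M\<close> replaces each exponential by a second factor
  \<open>b (j - k)\<close>, which gives the squared norm. The normalised form tends to 0 at every frequency, because
  a countable set is null for an atomless measure, and it is bounded by 1.\<close>

lemma atomless_imp_hilbert_schmidt_norm_tendsto:
  assumes "real_distribution M" and char: "\<And>t. char M (of_int t) = of_real (b t)"
    and atomless: "\<And>a. measure M {a} = 0"
  shows "(\<lambda>N. hilbert_schmidt_norm (correlation_mat b N) / real N) \<longlonglongrightarrow> 0"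
proof -
  interpret real_distribution M by fact
  have null: "measure M {x. iexp (x + a) = 1} = 0" for a
  proof -
    have "{x. iexp (x + a) = 1} \<subseteq> range (\<lambda>n::int. of_int (2 * n) * pi - a)"
      
    proof
      fix x assume "x \<in> {x. iexp (x + a) = 1}"
      then obtain n :: int where "x + a = of_int (2 * n) * pi"
        by (auto simp: exp_eq_1)
      then have "x = of_int (2 * n) * pi - a" by linarith
      then show "x \<in> range (\<lambda>n::int. of_int (2 * n) * pi - a)" by blast
    qed
    then have "countable {x. iexp (x + a) = 1}"
      by (rule countable_subset) simp
    then have "emeasure M {x. iexp (x + a) = 1} = (\<integral>\<^sup>+x. emeasure M {x} \<partial>count_space {x. iexp (x + a) = 1})"
      by (intro emeasure_countable_singleton) auto
    also have "\<dots> = 0"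
      by (simp add: emeasure_eq_measure atomless)
    finally show ?thesis by (simp add: measure_def)
  qed
  have c: "char M (real j - real k) = of_real (b (int j - int k))" for j k
    using char[of "int j - int k"] by simp
  have "(\<lambda>N. CLINT x|M. toeplitz_form b N x / of_nat N ^ 2) \<longlonglongrightarrow> (CLINT x|M. 0)"
  proof (rule integral_dominated_convergence[where w = "\<lambda>_. 1"])
    show "AE x in M. (\<lambda>N. toeplitz_form b N x / of_nat N ^ 2) \<longlonglongrightarrow> 0"
      using toeplitz_form_tendsto[OF char, unfolded null of_real_0] by (intro AE_I2)
    show "AE x in M. norm (toeplitz_form b N x / of_nat N ^ 2) \<le> 1" for N
      using toeplitz_form_norm_le[OF char] by (intro AE_I2)
    show "(\<lambda>x. toeplitz_form b N x / of_nat N ^ 2) \<in> borel_measurable M" for N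
      unfolding toeplitz_form_def divide_inverse
      by (intro measurable_finite_borel borel_measurable_continuous_onI continuous_intros)
  qed (auto simp: prob_space)
  moreover have "(CLINT x|M. toeplitz_form b N x / of_nat N ^ 2) =
      of_real ((hilbert_schmidt_norm (correlation_mat b N) / real N)\<^sup>2)" for N
  proof -
    have "(CLINT x|M. toeplitz_form b N x / of_nat N ^ 2) =
        (\<Sum>j<N. \<Sum>k<N. of_real (b (int j - int k)) * char M (real j - real k)) / of_nat N ^ 2"
      unfolding toeplitz_form_def char_def
      using integrable_iexp_affine[of _ 0, simplified add_0_right]
      by (simp del: of_real_mult of_real_diff)
    also have "\<dots> = of_real ((\<Sum>j<N. \<Sum>k<N. (b (int j - int k))\<^sup>2) / real N ^ 2)"
      unfolding c of_real_divide of_real_sum power2_eq_square of_real_mult of_real_of_nat_eq ..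
    also have "(\<Sum>j<N. \<Sum>k<N. (b (int j - int k))\<^sup>2) / real N ^ 2 =
        (hilbert_schmidt_norm (correlation_mat b N) / real N)\<^sup>2"
      by (simp add: hilbert_schmidt_norm_def correlation_mat_def power_divide sum_nonneg)
    finally show ?thesis .
  qed
  ultimately have "(\<lambda>N. complex_of_real ((hilbert_schmidt_norm (correlation_mat b N) / real N)\<^sup>2)) \<longlonglongrightarrow> of_real 0"
    by simp
  then have "(\<lambda>N. (hilbert_schmidt_norm (correlation_mat b N) / real N)\<^sup>2) \<longlonglongrightarrow> 0"
    unfolding tendsto_of_real_iff .
  then show ?thesis by simp
qed

section \<open>Riemann--Stieltjes integrals with respect to distribution functions\<close>

text \<open>Cousin's lemma supplies a tagged division finer than two given meshes, on which the Riemann--Stieltjes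
  sum is close to both values.\<close>

lemma has_RS_integral_unique:
  assumes "has_RS_integral f \<sigma> a b I" "has_RS_integral f \<sigma> a b J"
  shows "I = J"
proof (rule ccontr)
  assume "I \<noteq> J"
  define e where "e = norm (I - J) / 2"
  have "e > 0" using \<open>I \<noteq> J\<close> by (simp add: e_def)
  define S where "S D = (\<Sum>(x, K)\<in>D. (\<sigma> (Sup K) - \<sigma> (Inf K)) *\<^sub>R f x)" for D
  obtain d where d: "d > 0" "\<forall>D. D tagged_division_of {a..b} \<and> (\<lambda>x. ball x d) fine D \<longrightarrow> norm (S D - I) < e"
    using assms(1) \<open>e > 0\<close> unfolding has_RS_integral_def S_def[symmetric] by auto
  obtain d' where d': "d' > 0" "\<forall>D. D tagged_division_of {a..b} \<and> (\<lambda>x. ball x d') fine D \<longrightarrow> norm (S D - J) < e"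
    using assms(2) \<open>e > 0\<close> unfolding has_RS_integral_def S_def[symmetric] by auto
  have "gauge (\<lambda>x::real. ball x d \<inter> ball x d')"
    using d(1) d'(1) by (intro gauge_Int gauge_ball)
  then obtain D where D: "D tagged_division_of {a..b}" "(\<lambda>x. ball x d \<inter> ball x d') fine D"
    by (rule fine_division_exists_real)
  then have "(\<lambda>x. ball x d) fine D" "(\<lambda>x. ball x d') fine D"
    by (simp_all add: fine_Int)
  then have "norm (S D - I) < e" "norm (S D - J) < e"
    using d(2) d'(2) D(1) by auto
  then have "norm (I - J) < 2 * e"
    using norm_triangle_ineq4[of "S D - J" "S D - I"] by simp
  then show False by (simp add: e_def)
qed

lemma tagged_division_of_intervalE:
  assumes "D tagged_division_of {a..b::real}" "(x, K) \<in> D"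
  obtains u v where "K = {u..v}" "u \<le> x" "x \<le> v" "a \<le> u" "v \<le> b"
proof -
  obtain u v where K: "K = cbox u v" using tagged_division_ofD(4)[OF assms] by blast
  with tagged_division_ofD(2,3)[OF assms] that[of u v] show thesis by auto
qed

text \<open>Riemann--Stieltjes sums only see increments of the integrator inside \<open>[a, b]\<close>. This lets a spectral
  distribution function be replaced by a normalised extension of it to the real line.\<close>

lemma has_RS_integral_shift:
  assumes eq: "\<And>x. x \<in> {a..b} \<Longrightarrow> \<sigma> x = \<tau> x + c"
    and "has_RS_integral f \<sigma> a b I"
  shows "has_RS_integral f \<tau> a b I"
proof -
  have "(\<Sum>(x, K)\<in>D. (\<sigma> (Sup K) - \<sigma> (Inf K)) *\<^sub>R f x) = (\<Sum>(x, K)\<in>D. (\<tau> (Sup K) - \<tau> (Inf K)) *\<^sub>R f x)"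
    if D: "D tagged_division_of {a..b}" for D
  proof (intro sum.cong refl, clarify)
    fix x K assume "(x, K) \<in> D"
    then obtain u v where "K = {u..v}" "u \<le> x" "x \<le> v" "a \<le> u" "v \<le> b"
      by (rule tagged_division_of_intervalE[OF D])
    then show "(\<sigma> (Sup K) - \<sigma> (Inf K)) *\<^sub>R f x = (\<tau> (Sup K) - \<tau> (Inf K)) *\<^sub>R f x"
      using eq[of u] eq[of v] by simp
  qed
  note sums = this
  show ?thesis
    unfolding has_RS_integral_def
  proof (intro allI impI)
    fix \<epsilon> :: real assume "\<epsilon> > 0"
    then obtain \<delta> where \<delta>: "\<delta> > 0" "\<forall>D. D tagged_division_of {a..b} \<and> (\<lambda>x. ball x \<delta>) fine D \<longrightarrow>
        norm ((\<Sum>(x, K)\<in>D. (\<sigma> (Sup K) - \<sigma> (Inf K)) *\<^sub>R f x) - I) < \<epsilon>"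
      using assms(2) unfolding has_RS_integral_def by blast
    then show "\<exists>\<delta>>0. \<forall>D. D tagged_division_of {a..b} \<and> (\<lambda>x. ball x \<delta>) fine D \<longrightarrow>
        norm ((\<Sum>(x, K)\<in>D. (\<tau> (Sup K) - \<tau> (Inf K)) *\<^sub>R f x) - I) < \<epsilon>"
      by (intro exI[of _ \<delta>]) (auto simp flip: sums)
  qed
qed

context finite_borel_measure
begin

text \<open>Both the increments of the distribution function and the integrals \<open>G v - G u\<close> of \<open>f\<close> over \<open>(u, v]\<close>
  telescope over a tagged division. On each piece they differ, after multiplication of the former by
  the value of \<open>f\<close> at the tag, by at most the oscillation of \<open>f\<close> times the mass of the piece; uniform
  continuity bounds the total.\<close>

theorem has_RS_integral_cdf:
  assumes "a \<le> b" and cont: "continuous_on {a..b} f"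
  shows "has_RS_integral f (cdf M) a b (set_lebesgue_integral M {a<..b} f)"
  unfolding has_RS_integral_def
proof (intro allI impI)
  fix \<epsilon> :: real assume "\<epsilon> > 0"
  define m where "m = measure M (space M)"
  have "m \<ge> 0" by (simp add: m_def)
  \<comment> \<open>The 1 in the denominator covers the zero measure and makes the final estimate strict.\<close>
  define e where "e = \<epsilon> / (m + 1)"
  have "e > 0" using \<open>\<epsilon> > 0\<close> \<open>m \<ge> 0\<close> by (simp add: e_def)
  have "uniformly_continuous_on {a..b} f"
    using cont by (rule compact_uniformly_continuous) simp
  then obtain \<delta> where \<delta>: "\<delta> > 0" "\<And>x y. x \<in> {a..b} \<Longrightarrow> y \<in> {a..b} \<Longrightarrow> dist x y < \<delta> \<Longrightarrow> dist (f x) (f y) < e"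
    unfolding uniformly_continuous_on_def using \<open>e > 0\<close> by metis
  have int_ab: "set_integrable M {a..b} f"
  proof -
    have "bounded (f ` {a..b})"
      using cont by (intro compact_imp_bounded compact_continuous_image) auto
    then obtain B where B: "\<forall>x\<in>{a..b}. norm (f x) \<le> B"
      by (auto simp: bounded_iff)
    have "(\<lambda>x. indicator {a..b} x *\<^sub>R f x) \<in> borel_measurable M"
      unfolding measurable_cong_sets[OF M_is_borel refl]
      using cont by (intro borel_measurable_continuous_on_indicator) auto
    then show ?thesis unfolding set_integrable_def
      using B by (intro integrable_const_bound[of _ "max 0 B"] AE_I2) (auto simp: indicator_def le_max_iff_disj)
  qed
  have int: "set_integrable M {u<..v} f" if "a \<le> u" "v \<le> b" for u v
    using that by (intro set_integrable_subset[OF int_ab]) (auto simp: M_is_borel)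
  define G where "G x = set_lebesgue_integral M {a<..x} f" for x
  have step: "norm ((cdf M v - cdf M u) *\<^sub>R f x - (G v - G u)) \<le> e * (cdf M v - cdf M u)"
    if "a \<le> u" "u \<le> x" "x \<le> v" "v \<le> b" and near: "{u..v} \<subseteq> ball x \<delta>" for u v x
  proof -
    have [measurable]: "{u<..v} \<in> sets M" by (simp add: M_is_borel)
    have const: "set_integrable M {u<..v} (\<lambda>_. f x)"
      unfolding set_integrable_def
      by (intro integrable_scaleR_left integrable_real_indicator) (auto simp: less_top[symmetric])
    have "{a<..v} = {a<..u} \<union> {u<..v}" using that by auto
    then have "G v = G u + set_lebesgue_integral M {u<..v} f"
      unfolding G_def using that by (simp add: set_integral_Un int)
    moreover have "cdf M v - cdf M u = measure M {u<..v}"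
      using that cdf_diff_eq[of u v] by (cases "u = v") auto
    moreover have "measure M {u<..v} *\<^sub>R f x = set_lebesgue_integral M {u<..v} (\<lambda>_. f x)"
      using integral_scaleR_left[of "f x" M "indicator {u<..v}"]
      by (simp add: set_lebesgue_integral_def borel_UNIV less_top[symmetric])
    moreover have "set_lebesgue_integral M {u<..v} (\<lambda>_. f x) - set_lebesgue_integral M {u<..v} f
        = set_lebesgue_integral M {u<..v} (\<lambda>y. f x - f y)"
      using that by (intro set_integral_diff(2)[symmetric] const int)
    moreover have "norm (set_lebesgue_integral M {u<..v} (\<lambda>y. f x - f y)) \<le> (LINT y|M. indicator {u<..v} y * e)"
      unfolding set_lebesgue_integral_def
    proof (rule Bochner_Integration.integral_norm_bound_integral)
      show "integrable M (\<lambda>y. indicator {u<..v} y *\<^sub>R (f x - f y))"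
        using set_integral_diff(1)[OF const int[of u v]] that by (simp add: set_integrable_def)
      show "norm (indicator {u<..v} y *\<^sub>R (f x - f y)) \<le> indicator {u<..v} y * e" for y
      proof (cases "y \<in> {u<..v}")
        case True
        then have "y \<in> ball x \<delta>" by (intro subsetD[OF near]) (use True in auto)
        then have "dist (f x) (f y) < e"
          using that True by (intro \<delta>) auto
        then show ?thesis using True by (simp add: dist_norm)
      qed simp
    qed (simp add: less_top[symmetric])
    ultimately show ?thesis by (simp add: mult.commute)
  qed
  show "\<exists>\<delta>>0. \<forall>D. D tagged_division_of {a..b} \<and> (\<lambda>x. ball x \<delta>) fine D \<longrightarrow>
      norm ((\<Sum>(x, K)\<in>D. (cdf M (Sup K) - cdf M (Inf K)) *\<^sub>R f x) - set_lebesgue_integral M {a<..b} f) < \<epsilon>"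
  proof (intro exI[of _ \<delta>] conjI allI impI)
    fix D assume "D tagged_division_of {a..b} \<and> (\<lambda>x. ball x \<delta>) fine D"
    then have D: "D tagged_division_of {a..b}" and fine: "(\<lambda>x. ball x \<delta>) fine D" by auto
    have "set_lebesgue_integral M {a<..b} f = (\<Sum>(x, K)\<in>D. G (Sup K) - G (Inf K))"
      using additive_tagged_division_1[OF \<open>a \<le> b\<close> D, of G] by (simp add: G_def set_lebesgue_integral_def)
    then have "norm ((\<Sum>(x, K)\<in>D. (cdf M (Sup K) - cdf M (Inf K)) *\<^sub>R f x) - set_lebesgue_integral M {a<..b} f)
        = norm (\<Sum>(x, K)\<in>D. (cdf M (Sup K) - cdf M (Inf K)) *\<^sub>R f x - (G (Sup K) - G (Inf K)))"
      by (simp add: sum_subtractf case_prod_unfold)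
    also have "\<dots> \<le> (\<Sum>(x, K)\<in>D. e * (cdf M (Sup K) - cdf M (Inf K)))"
    proof (rule sum_norm_le, clarify)
      fix x K assume xK: "(x, K) \<in> D"
      then obtain u v where K: "K = {u..v}" "u \<le> x" "x \<le> v" "a \<le> u" "v \<le> b"
        by (rule tagged_division_of_intervalE[OF D])
      have "K \<subseteq> ball x \<delta>" using fine xK by (auto simp: fine_def)
      with K step[of u x v]
      show "norm ((cdf M (Sup K) - cdf M (Inf K)) *\<^sub>R f x - (G (Sup K) - G (Inf K)))
          \<le> e * (cdf M (Sup K) - cdf M (Inf K))" by auto
    qed
    also have "\<dots> = e * (\<Sum>(x, K)\<in>D. cdf M (Sup K) - cdf M (Inf K))"
      by (simp add: sum_distrib_left case_prod_unfold)
    also have "\<dots> = e * (cdf M b - cdf M a)"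
      by (simp only: additive_tagged_division_1[OF \<open>a \<le> b\<close> D])
    also have "\<dots> \<le> e * m"
      using \<open>e > 0\<close> cdf_bounded[of b] cdf_nonneg[of a] by (intro mult_left_mono) (auto simp: m_def)
    also have "\<dots> < \<epsilon>"
      using \<open>\<epsilon> > 0\<close> \<open>m \<ge> 0\<close> by (simp add: e_def field_simps)
    finally show "norm ((\<Sum>(x, K)\<in>D. (cdf M (Sup K) - cdf M (Inf K)) *\<^sub>R f x) - set_lebesgue_integral M {a<..b} f) < \<epsilon>" .
  qed (rule \<delta>)
qed

end

corollary (in real_distribution) has_RS_integral_cdf_char:
  assumes "a \<le> b" "cdf M a = 0" "cdf M b = 1"
  shows "has_RS_integral (\<lambda>\<theta>. exp (\<i> * of_int t * of_real \<theta>)) (cdf M) a b (char M (of_int t))"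
proof -
  have "measure M {a<..b} = 1"
    using assms cdf_diff_eq[of a b] by (cases "a = b") auto
  then have "AE x in M. x \<in> {a<..b}"
    by (intro AE_prob_1)
  then have "AE x in M. iexp (of_int t * x) = indicator {a<..b} x *\<^sub>R exp (\<i> * of_int t * of_real x)"
    by eventually_elim (simp add: mult.assoc)
  then have "char M (of_int t) = (CLINT x|M. indicator {a<..b} x *\<^sub>R exp (\<i> * of_int t * of_real x))"
    unfolding char_def by (intro integral_cong_AE) auto
  moreover have "has_RS_integral (\<lambda>\<theta>. exp (\<i> * of_int t * of_real \<theta>)) (cdf M) a b
      (set_lebesgue_integral M {a<..b} (\<lambda>\<theta>. exp (\<i> * of_int t * of_real \<theta>)))"
    by (intro has_RS_integral_cdf assms continuous_intros)
  ultimately show ?thesis by (simp add: set_lebesgue_integral_def)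
qed

section \<open>Herglotz' theorem\<close>

lemma has_bochner_integral_iexp_period:
  "has_bochner_integral lborel (\<lambda>x. indicator {-pi..pi} x *\<^sub>R iexp (of_int m * x))
     (of_real (if m = 0 then 2 * pi else 0))"
proof (cases "m = 0")
  case True
  have "has_bochner_integral lborel (\<lambda>x. indicator {-pi..pi} x *\<^sub>R (1::complex)) (of_real pi - of_real (-pi))"
    by (rule has_bochner_integral_FTC_Icc) (auto intro!: derivative_eq_intros)
  then show ?thesis using True by simp
next
  case False
  define F where "F x = iexp (of_int m * x) / (\<i> * of_int m)" for x
  have "has_bochner_integral lborel (\<lambda>x. indicator {-pi..pi} x *\<^sub>R iexp (of_int m * x)) (F pi - F (-pi))"
  proof (rule has_bochner_integral_FTC_Icc)
    show "(F has_vector_derivative iexp (of_int m * x)) (at x within {-pi..pi})" for x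
    proof -
      have "((\<lambda>z. exp (\<i> * (of_int m * z)) / (\<i> * of_int m)) has_field_derivative
          iexp (of_int m * x)) (at (of_real x))"
        using False by (auto intro!: derivative_eq_intros simp: mult.commute[of _ \<i>])
      from has_vector_derivative_real_field[OF this] show ?thesis
        unfolding F_def by simp
    qed
  qed (auto intro!: continuous_intros)
  moreover have "iexp (of_int m * pi) = iexp (of_int m * (-pi))"
  proof -
    have "iexp (of_int m * pi) / iexp (of_int m * (-pi)) = iexp (2 * of_int m * pi)"
      by (simp add: algebra_simps flip: exp_diff)
    also have "\<dots> = 1"
      by (simp add: exp_eq_1)
    finally show ?thesis by simp
  qed
  ultimately show ?thesis using False by (simp add: F_def)
qed

text \<open>The diagonal \<open>j - k = t\<close> of an \<open>N \<times> N\<close> matrix has \<open>N - \<bar>t\<bar>\<close> entries once \<open>N > \<bar>t\<bar>\<close>; after division by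
  \<open>N\<close> these are the Fejer weights.\<close>

lemma card_diagonal_tendsto:
  "(\<lambda>N. (\<Sum>j<N. \<Sum>k<N. if int j - int k = t then 1 else 0) / real N) \<longlonglongrightarrow> 1"
proof -
  have "eventually (\<lambda>N. (\<Sum>j<N. \<Sum>k<N. if int j - int k = t then 1 else 0) / real N
      = 1 - \<bar>of_int t\<bar> / real N) sequentially"
  proof (intro eventually_sequentiallyI[of "Suc (nat \<bar>t\<bar>)"])
    fix N assume N: "Suc (nat \<bar>t\<bar>) \<le> N"
    have "(\<Sum>k<N. if int j - int k = t then 1 else 0 :: real) = of_bool (t \<le> int j \<and> int j < int N + t)" for j
    proof -
      have "(\<Sum>k<N. if int j - int k = t then 1 else 0 :: real) = (\<Sum>k<N. if k = nat (int j - t) then of_bool (t \<le> int j) else 0)"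
        by (intro sum.cong) auto
      also have "\<dots> = of_bool (t \<le> int j \<and> int j < int N + t)"
        by (auto simp: nat_less_iff)
      finally show ?thesis .
    qed
    then have "(\<Sum>j<N. \<Sum>k<N. if int j - int k = t then 1 else 0 :: real)
        = real (card ({..<N} \<inter> {j. t \<le> int j \<and> int j < int N + t}))"
      by (simp add: of_bool_def sum.If_cases)
    also have "{..<N} \<inter> {j. t \<le> int j \<and> int j < int N + t} = {nat t..<min N (nat (int N + t))}"
      by auto
    also have "real (card {nat t..<min N (nat (int N + t))}) = real N - \<bar>of_int t\<bar>"
      using N by (cases "t \<ge> 0") (auto simp: of_nat_diff min_def)
    finally show "(\<Sum>j<N. \<Sum>k<N. if int j - int k = t then 1 else 0) / real N = 1 - \<bar>of_int t\<bar> / real N"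
      using N by (simp add: diff_divide_distrib)
  qed
  moreover have "(\<lambda>N. 1 - \<bar>of_int t\<bar> / real N) \<longlonglongrightarrow> 1 - 0"
    by (intro tendsto_diff tendsto_const lim_const_over_n)
  ultimately show ?thesis
    using tendsto_cong by fastforce
qed

text \<open>The assumption \<open>pos\<close> is positive semidefiniteness restricted to the vectors of exponentials, in the
  form that evenness of \<open>b\<close> allows: it says that the Cesaro means of the Fourier series of \<open>b\<close>
  are nonnegative.\<close>

locale correlation_sequence =
  fixes b :: "int \<Rightarrow> real"
  assumes even: "b (- t) = b t" and zero: "b 0 = 1"
    and pos: "(\<Sum>j<N. \<Sum>k<N. b (int j - int k) * cos ((real j - real k) * x)) \<ge> 0"
begin

text \<open>The Cesaro mean of the formal Fourier series of the spectral measure, cut off to one period.\<close>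

definition fejer_density :: "nat \<Rightarrow> real \<Rightarrow> real" where
  "fejer_density N x = indicator {-pi..pi} x *
     (\<Sum>j<N. \<Sum>k<N. b (int j - int k) * cos ((real j - real k) * x)) / (2 * pi * real N)"

definition fejer_measure :: "nat \<Rightarrow> real measure" where
  "fejer_measure N = density lborel (\<lambda>x. ennreal (fejer_density N x))"

lemma fejer_density_nonneg: "fejer_density N x \<ge> 0"
  unfolding fejer_density_def by (intro divide_nonneg_nonneg mult_nonneg_nonneg pos) auto

lemma fejer_density_measurable [measurable]: "fejer_density N \<in> borel_measurable borel"
  unfolding fejer_density_def by measurable

lemma fejer_density_minus: "fejer_density N (- x) = fejer_density N x"
proof -
  have "indicator {-pi..pi} (- x) = (indicator {-pi..pi} x :: real)"
    by (auto simp: indicator_def)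
  then show ?thesis by (simp add: fejer_density_def)
qed

text \<open>The imaginary part is a sum that changes its sign when \<open>j\<close> and \<open>k\<close> are exchanged.\<close>

lemma cos_sum_eq_iexp_sum:
  "of_real (\<Sum>j<N. \<Sum>k<N. b (int j - int k) * cos ((real j - real k) * x)) =
     (\<Sum>j<N. \<Sum>k<N. of_real (b (int j - int k)) * iexp (of_int (int k - int j) * x))" (is "_ = ?R")
proof -
  define S where "S = (\<Sum>j<N. \<Sum>k<N. b (int j - int k) * sin ((real k - real j) * x))"
  have "S = (\<Sum>k<N. \<Sum>j<N. b (int j - int k) * sin ((real k - real j) * x))"
    unfolding S_def by (rule sum.swap)
  also have "\<dots> = (\<Sum>k<N. \<Sum>j<N. - (b (int k - int j) * sin ((real j - real k) * x)))"
  proof (intro sum.cong refl)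
    fix j k
    show "b (int j - int k) * sin ((real k - real j) * x) = - (b (int k - int j) * sin ((real j - real k) * x))"
      using even[of "int j - int k"] sin_minus[of "(real k - real j) * x"] by (simp add: algebra_simps)
  qed
  also have "\<dots> = - S"
    unfolding S_def by (simp only: sum_negf)
  finally have S: "S = 0" by simp
  have "Re ?R = (\<Sum>j<N. \<Sum>k<N. b (int j - int k) * cos ((real k - real j) * x))"
    by (simp add: Re_exp)
  also have "\<dots> = (\<Sum>j<N. \<Sum>k<N. b (int j - int k) * cos ((real j - real k) * x))"
  proof (intro sum.cong refl)
    fix j k
    show "b (int j - int k) * cos ((real k - real j) * x) = b (int j - int k) * cos ((real j - real k) * x)"
      using cos_minus[of "(real k - real j) * x"] by (simp add: algebra_simps)
  qed
  finally have "Re ?R = (\<Sum>j<N. \<Sum>k<N. b (int j - int k) * cos ((real j - real k) * x))" .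
  moreover have "Im ?R = S"
    unfolding S_def by (simp add: Im_exp)
  ultimately show ?thesis
    using S by (intro complex_eqI) (simp_all del: of_real_sum)
qed

text \<open>Orthogonality of the exponentials on one period selects the diagonal \<open>j - k = t\<close>, on which \<open>b\<close> is
  constant.\<close>

lemma has_bochner_integral_fejer_density:
  "has_bochner_integral lborel (\<lambda>x. fejer_density N x *\<^sub>R iexp (of_int t * x))
     (of_real (b t * ((\<Sum>j<N. \<Sum>k<N. if int j - int k = t then 1 else 0) / real N)))"
proof -
  have "has_bochner_integral lborel
     (\<lambda>x. \<Sum>j<N. \<Sum>k<N. of_real (b (int j - int k) / (2 * pi * real N)) *
         (indicator {-pi..pi} x *\<^sub>R iexp (of_int (t - (int j - int k)) * x)))
     (\<Sum>j<N. \<Sum>k<N. of_real (b (int j - int k) / (2 * pi * real N)) *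
         of_real (if t - (int j - int k) = 0 then 2 * pi else 0))"
    by (intro has_bochner_integral_sum has_bochner_integral_mult_right has_bochner_integral_iexp_period)
  moreover have "(\<Sum>j<N. \<Sum>k<N. of_real (b (int j - int k) / (2 * pi * real N)) *
         (indicator {-pi..pi} x *\<^sub>R iexp (of_int (t - (int j - int k)) * x)))
      = fejer_density N x *\<^sub>R iexp (of_int t * x)" for x
  proof -
    have e: "iexp (of_int (t - (int j - int k)) * x) = iexp (of_int (int k - int j) * x) * iexp (of_int t * x)" for j k
      by (simp add: algebra_simps flip: exp_add)
    have "fejer_density N x *\<^sub>R iexp (of_int t * x) =
        of_real (\<Sum>j<N. \<Sum>k<N. b (int j - int k) * cos ((real j - real k) * x)) *
          (of_real (indicator {-pi..pi} x / (2 * pi * real N)) * iexp (of_int t * x))"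
      by (simp add: fejer_density_def scaleR_conv_of_real)
    also have "\<dots> = (\<Sum>j<N. \<Sum>k<N. of_real (b (int j - int k) / (2 * pi * real N)) *
         (indicator {-pi..pi} x *\<^sub>R iexp (of_int (t - (int j - int k)) * x)))"
      unfolding cos_sum_eq_iexp_sum sum_distrib_right e
      by (intro sum.cong refl) (simp add: scaleR_conv_of_real)
    finally show ?thesis ..
  qed
  moreover have "(\<Sum>j<N. \<Sum>k<N. of_real (b (int j - int k) / (2 * pi * real N)) *
         of_real (if t - (int j - int k) = 0 then 2 * pi else 0))
      = (of_real (b t * ((\<Sum>j<N. \<Sum>k<N. if int j - int k = t then 1 else 0) / real N)) :: complex)"
  proof -
    have "b (int j - int k) / (2 * pi * real N) * (if t - (int j - int k) = 0 then 2 * pi else 0)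
        = b t / real N * (if int j - int k = t then 1 else 0)" for j k
      by auto
    then have "(\<Sum>j<N. \<Sum>k<N. b (int j - int k) / (2 * pi * real N) * (if t - (int j - int k) = 0 then 2 * pi else 0))
        = (\<Sum>j<N. \<Sum>k<N. b t / real N * (if int j - int k = t then 1 else 0))"
      by simp
    also have "\<dots> = b t * ((\<Sum>j<N. \<Sum>k<N. if int j - int k = t then 1 else 0) / real N)"
      by (simp add: sum_distrib_left sum_divide_distrib)
    finally show ?thesis
      unfolding of_real_mult[symmetric] of_real_sum[symmetric] by (rule arg_cong)
  qed
  ultimately show ?thesis by simp
qed

lemma char_fejer_measure:
  "char (fejer_measure N) (of_int t) =
     of_real (b t * ((\<Sum>j<N. \<Sum>k<N. if int j - int k = t then 1 else 0) / real N))"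
proof -
  have "char (fejer_measure N) (of_int t) = (CLINT x|lborel. fejer_density N x *\<^sub>R iexp (of_int t * x))"
    unfolding char_def fejer_measure_def
    by (intro integral_density) (auto simp: fejer_density_nonneg)
  then show ?thesis
    using has_bochner_integral_integral_eq[OF has_bochner_integral_fejer_density] by simp
qed

lemma real_distribution_fejer_measure:
  assumes "N > 0"
  shows "real_distribution (fejer_measure N)"
proof -
  have "has_bochner_integral lborel (\<lambda>x. Re (fejer_density N x *\<^sub>R iexp (of_int 0 * x)))
      (Re (of_real (b 0 * ((\<Sum>j<N. \<Sum>k<N. if int j - int k = 0 then 1 else 0) / real N))))"
    by (rule has_bochner_integral_bounded_linear[OF bounded_linear_Re has_bochner_integral_fejer_density])
  then have "has_bochner_integral lborel (fejer_density N) 1"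
    using assms by (simp add: zero)
  then have "(\<integral>\<^sup>+x. ennreal (fejer_density N x) \<partial>lborel) = 1"
    using nn_integral_eq_integral[of lborel "fejer_density N"]
    by (simp add: has_bochner_integral_iff fejer_density_nonneg)
  then have "emeasure (fejer_measure N) (space (fejer_measure N)) = 1"
    by (simp add: fejer_measure_def emeasure_density)
  then interpret prob_space "fejer_measure N" by (rule prob_spaceI)
  show ?thesis
    by unfold_locales (simp_all add: fejer_measure_def)
qed

lemma measure_fejer_measure_null:
  assumes "A \<in> sets borel" "AE x in lborel. x \<in> A \<longrightarrow> x \<notin> {-pi..pi}"
  shows "measure (fejer_measure N) A = 0"
proof -
  have "emeasure (fejer_measure N) A = (\<integral>\<^sup>+x. ennreal (fejer_density N x) * indicator A x \<partial>lborel)"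
    using assms by (simp add: fejer_measure_def emeasure_density)
  also have "\<dots> = (\<integral>\<^sup>+(x::real). 0 \<partial>lborel)"
    using assms(2) by (intro nn_integral_cong_AE, elim eventually_mono) (auto simp: fejer_density_def indicator_def)
  finally show ?thesis by (simp add: measure_def)
qed

lemma cdf_fejer_measure_outside:
  assumes "x \<le> -pi"
  shows "cdf (fejer_measure N) x = 0"
proof -
  have "AE y in lborel. y \<noteq> -pi" by (rule AE_lborel_singleton)
  then show ?thesis
    unfolding cdf_def using assms
    by (intro measure_fejer_measure_null) (auto elim!: eventually_mono)
qed

text \<open>The density is even, and the point \<open>x\<close> itself carries no mass.\<close>

lemma cdf_fejer_measure_symmetric:
  assumes "N > 0"
  shows "cdf (fejer_measure N) x + cdf (fejer_measure N) (- x) = 1"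
proof -
  interpret real_distribution "fejer_measure N"
    using assms by (rule real_distribution_fejer_measure)
  have "emeasure (fejer_measure N) {..- x} = (\<integral>\<^sup>+y. ennreal (fejer_density N y) * indicator {..- x} y \<partial>distr lborel borel uminus)"
    by (simp add: fejer_measure_def emeasure_density lborel_distr_uminus)
  also have "\<dots> = (\<integral>\<^sup>+y. ennreal (fejer_density N (- y)) * indicator {..- x} (- y) \<partial>lborel)"
    by (intro nn_integral_distr) auto
  also have "\<dots> = (\<integral>\<^sup>+y. ennreal (fejer_density N y) * indicator {x..} y \<partial>lborel)"
    by (intro nn_integral_cong) (auto simp: fejer_density_minus indicator_def)
  also have "\<dots> = (\<integral>\<^sup>+y. ennreal (fejer_density N y) * indicator {x<..} y \<partial>lborel)"
    using AE_lborel_singleton[of x]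
    by (intro nn_integral_cong_AE, elim eventually_mono) (auto simp: indicator_def)
  also have "\<dots> = emeasure (fejer_measure N) {x<..}"
    by (simp add: fejer_measure_def emeasure_density)
  finally have "cdf (fejer_measure N) (- x) = prob {x<..}"
    by (simp add: cdf_def measure_def)
  also have "\<dots> = 1 - cdf (fejer_measure N) x"
    using prob_compl[of "{..x}"] by (simp add: cdf_def Compl_eq_Diff_UNIV[symmetric])
  finally show ?thesis by simp
qed

text \<open>The Fejer measures live on a fixed compact interval, so a subsequence converges weakly, and its
  Fourier coefficients converge to \<open>b\<close>. The statements on the limiting distribution function \<open>cdf \<mu>\<close> are confined
  to continuity points because weak convergence controls it only there.\<close>

theorem herglotz:
  obtains \<mu> where "real_distribution \<mu>" "\<And>t. char \<mu> (of_int t) = of_real (b t)"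
    "\<And>x. x \<le> -pi \<Longrightarrow> isCont (cdf \<mu>) x \<Longrightarrow> cdf \<mu> x = 0"
    "\<And>x. isCont (cdf \<mu>) x \<Longrightarrow> isCont (cdf \<mu>) (- x) \<Longrightarrow> cdf \<mu> x + cdf \<mu> (- x) = 1"
proof -
  \<comment> \<open>The order 0 would give the zero measure.\<close>
  define F where "F n = fejer_measure (Suc n)" for n
  have F: "real_distribution (F n)" for n
    unfolding F_def by (rule real_distribution_fejer_measure) simp
  have F_out: "cdf (F n) x = 0" if "x \<le> -pi" for n x
    unfolding F_def using that by (rule cdf_fejer_measure_outside)
  have F_sym: "cdf (F n) x + cdf (F n) (- x) = 1" for n x
    unfolding F_def by (rule cdf_fejer_measure_symmetric) simp
  have "tight F"
    unfolding tight_def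
  proof (intro conjI allI impI F)
    fix \<epsilon> :: real assume "\<epsilon> > 0"
    have "1 - \<epsilon> < measure (F n) {- pi<..pi}" for n
    proof -
      interpret real_distribution "F n" by (rule F)
      show ?thesis
        using F_sym[of n pi] F_out[of "-pi" n] cdf_diff_eq[of "-pi" pi] \<open>\<epsilon> > 0\<close> by simp
    qed
    moreover have "-pi < pi" by simp
    ultimately show "\<exists>a b. a < b \<and> (\<forall>n. 1 - \<epsilon> < measure (F n) {a<..b})"
      by blast
  qed
  then obtain r \<mu> where r: "strict_mono (r :: nat \<Rightarrow> nat)" and \<mu>: "real_distribution \<mu>"
    and conv: "weak_conv_m (F \<circ> id \<circ> r) \<mu>"
    using tight_imp_convergent_subsubsequence[of F id] strict_mono_id by blast
  have cdf_lim: "(\<lambda>n. cdf (F (r n)) x) \<longlonglongrightarrow> cdf \<mu> x" if "isCont (cdf \<mu>) x" for x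
    using conv that by (simp add: weak_conv_m_def weak_conv_def)
  show thesis
  proof
    show "real_distribution \<mu>" by (rule \<mu>)
    show "char \<mu> (of_int t) = of_real (b t)" for t
    proof (rule LIMSEQ_unique)
      show "(\<lambda>n. char ((F \<circ> id \<circ> r) n) (of_int t)) \<longlonglongrightarrow> char \<mu> (of_int t)"
        using \<mu> conv by (intro levy_continuity1) (simp_all add: F comp_def)
      have "strict_mono (Suc \<circ> r)"
        using r by (simp add: strict_mono_def)
      from LIMSEQ_subseq_LIMSEQ[OF card_diagonal_tendsto this]
      have "(\<lambda>n. complex_of_real (b t * ((\<Sum>j<Suc (r n). \<Sum>k<Suc (r n). if int j - int k = t then 1 else 0) / real (Suc (r n)))))
          \<longlonglongrightarrow> of_real (b t * 1)"
        unfolding comp_def by (intro tendsto_of_real tendsto_mult tendsto_const)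
      then show "(\<lambda>n. char ((F \<circ> id \<circ> r) n) (of_int t)) \<longlonglongrightarrow> of_real (b t)"
        by (simp only: comp_def id_def F_def char_fejer_measure mult_1_right)
    qed
    show "cdf \<mu> x = 0" if "x \<le> -pi" "isCont (cdf \<mu>) x" for x
      using cdf_lim[OF that(2)] that(1) by (simp add: F_out LIMSEQ_const_iff)
    show "cdf \<mu> x + cdf \<mu> (- x) = 1" if "isCont (cdf \<mu>) x" "isCont (cdf \<mu>) (- x)" for x
      using tendsto_add[OF cdf_lim[OF that(1)] cdf_lim[OF that(2)]] by (simp add: F_sym LIMSEQ_const_iff)
  qed
qed

end

section \<open>Stability and the correlation matrices\<close>

text \<open>The cosine form of \<open>pos\<close> is the mean of the squared modulus of \<open>\<Sum>j<N. \<xi> j exp (i j x)\<close>, split into the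
  squares \<open>C\<^sup>2\<close> and \<open>S\<^sup>2\<close> of real and imaginary part.\<close>

lemma stationary_process_correlation_sequence:
  assumes st: "stationary_process M \<xi>"
    and var: "prob_space.expectation M (\<lambda>\<omega>. (\<xi> 0 \<omega>)\<^sup>2) = 1"
  shows "correlation_sequence (correlation M \<xi>)"
proof
  interpret prob_space M using st by (simp add: stationary_process_def)
  let ?b = "correlation M \<xi>"
  have [measurable]: "\<xi> t \<in> borel_measurable M" and sq: "integrable M (\<lambda>\<omega>. (\<xi> t \<omega>)\<^sup>2)" for t
    using st by (auto simp: stationary_process_def)
  have shift: "expectation (\<lambda>\<omega>. \<xi> (t + s) \<omega> * \<xi> s \<omega>) = ?b t" for t s
  proof -
    have "expectation (\<lambda>\<omega>. \<xi> (t + s) \<omega> * \<xi> s \<omega>) = expectation (\<lambda>\<omega>. \<xi> (t + 0) \<omega> * \<xi> 0 \<omega>)"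
      using st unfolding stationary_process_def by blast
    then show ?thesis by (simp add: correlation_def)
  qed
  have prod: "integrable M (\<lambda>\<omega>. \<xi> s \<omega> * \<xi> t \<omega>)" for s t
  proof (rule Bochner_Integration.integrable_bound)
    show "integrable M (\<lambda>\<omega>. (\<xi> s \<omega>)\<^sup>2 + (\<xi> t \<omega>)\<^sup>2)"
      by (intro Bochner_Integration.integrable_add sq)
    show "AE \<omega> in M. norm (\<xi> s \<omega> * \<xi> t \<omega>) \<le> norm ((\<xi> s \<omega>)\<^sup>2 + (\<xi> t \<omega>)\<^sup>2)"
    proof (rule AE_I2)
      fix \<omega>
      have "2 * (\<bar>\<xi> s \<omega>\<bar> * \<bar>\<xi> t \<omega>\<bar>) \<le> (\<xi> s \<omega>)\<^sup>2 + (\<xi> t \<omega>)\<^sup>2"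
        using sum_squares_bound[of "\<bar>\<xi> s \<omega>\<bar>" "\<bar>\<xi> t \<omega>\<bar>"] by (simp add: mult.assoc)
      moreover have "0 \<le> \<bar>\<xi> s \<omega>\<bar> * \<bar>\<xi> t \<omega>\<bar>"
        by simp
      ultimately have "\<bar>\<xi> s \<omega>\<bar> * \<bar>\<xi> t \<omega>\<bar> \<le> (\<xi> s \<omega>)\<^sup>2 + (\<xi> t \<omega>)\<^sup>2"
        by linarith
      then show "norm (\<xi> s \<omega> * \<xi> t \<omega>) \<le> norm ((\<xi> s \<omega>)\<^sup>2 + (\<xi> t \<omega>)\<^sup>2)"
        by (simp add: abs_mult)
    qed
  qed simp
  show "?b (- t) = ?b t" for t
    using shift[of "-t" t] by (simp add: correlation_def mult.commute)
  show "?b 0 = 1"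
    using var by (simp add: correlation_def power2_eq_square)
  show "(\<Sum>j<N. \<Sum>k<N. ?b (int j - int k) * cos ((real j - real k) * x)) \<ge> 0" for N x
  proof -
    define C where "C \<omega> = (\<Sum>j<N. cos (real j * x) * \<xi> (int j) \<omega>)" for \<omega>
    define S where "S \<omega> = (\<Sum>j<N. sin (real j * x) * \<xi> (int j) \<omega>)" for \<omega>
    have "(C \<omega>)\<^sup>2 + (S \<omega>)\<^sup>2 =
        (\<Sum>j<N. \<Sum>k<N. cos ((real j - real k) * x) * (\<xi> (int j) \<omega> * \<xi> (int k) \<omega>))" for \<omega>
    proof -
      have "cos ((real j - real k) * x) = cos (real j * x) * cos (real k * x) + sin (real j * x) * sin (real k * x)" for j k
        by (simp add: left_diff_distrib cos_diff)
      then show ?thesis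
        unfolding C_def S_def power2_eq_square sum_product
        by (simp add: sum.distrib[symmetric] algebra_simps)
    qed
    then have "expectation (\<lambda>\<omega>. (C \<omega>)\<^sup>2 + (S \<omega>)\<^sup>2) =
        (\<Sum>j<N. \<Sum>k<N. cos ((real j - real k) * x) * expectation (\<lambda>\<omega>. \<xi> (int j) \<omega> * \<xi> (int k) \<omega>))"
      by (simp add: prod)
    also have "\<dots> = (\<Sum>j<N. \<Sum>k<N. ?b (int j - int k) * cos ((real j - real k) * x))"
    proof (intro sum.cong refl)
      fix j k
      show "cos ((real j - real k) * x) * expectation (\<lambda>\<omega>. \<xi> (int j) \<omega> * \<xi> (int k) \<omega>)
          = ?b (int j - int k) * cos ((real j - real k) * x)"
        using shift[of "int j - int k" "int k"] by simp
    qed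
    finally show ?thesis
      using Bochner_Integration.integral_nonneg[of M "\<lambda>\<omega>. (C \<omega>)\<^sup>2 + (S \<omega>)\<^sup>2"] by simp
  qed
qed

text \<open>The values of \<open>\<sigma>\<close> outside \<open>[-\<pi>, \<pi>]\<close> are arbitrary. Replaced there by constants and normalised to
  start at 0, it is the distribution function of a probability measure, and uniqueness of the Riemann--Stieltjes integral
  identifies \<open>b\<close> with the Fourier coefficients of this measure.\<close>

lemma spectral_distribution_continuousE:
  assumes "spectral_distribution b \<sigma>" and cont: "continuous_on {-pi..pi} \<sigma>"
  obtains \<mu> where "real_distribution \<mu>" "\<And>t. char \<mu> (of_int t) = of_real (b t)" "\<And>a. measure \<mu> {a} = 0"
proof -
  have mono: "mono_on {-pi..pi} \<sigma>" and mass: "\<sigma> pi - \<sigma> (-pi) = 1"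
    and RS: "has_RS_integral (\<lambda>\<theta>. exp (\<i> * of_int t * of_real \<theta>)) \<sigma> (-pi) pi (of_real (b t))" for t
    using assms(1) by (auto simp: spectral_distribution_def)
  define F where "F x = \<sigma> (max (-pi) (min pi x)) - \<sigma> (-pi)" for x
  have F_mono: "F x \<le> F y" if "x \<le> y" for x y
    unfolding F_def using that mono_onD[OF mono, of "max (-pi) (min pi x)" "max (-pi) (min pi y)"]
    by (auto simp: max_def min_def)
  have "continuous_on UNIV (\<lambda>x. \<sigma> (max (-pi) (min pi x)))"
    by (rule continuous_on_compose2[OF cont]) (auto intro!: continuous_intros)
  then have F_cont: "isCont F x" for x
    unfolding F_def by (intro continuous_intros) (simp add: continuous_on_eq_continuous_at)
  have F_right: "continuous (at_right x) F" for x
    using F_cont by (rule continuous_at_imp_continuous_within)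
  have F_left: "F x = 0" if "x \<le> -pi" for x
  proof -
    have "x \<le> pi" using that pi_gt_zero by linarith
    then show ?thesis using that by (simp add: F_def)
  qed
  have F_right_end: "F x = 1" if "pi \<le> x" for x
    using that mass by (simp add: F_def)
  have F_bot: "(F \<longlongrightarrow> 0) at_bot"
    by (rule tendsto_eventually[OF eventually_mono[OF eventually_le_at_bot F_left]])
  have F_top: "(F \<longlongrightarrow> 1) at_top"
    by (rule tendsto_eventually[OF eventually_mono[OF eventually_ge_at_top F_right_end]])
  interpret real_distribution "interval_measure F"
    by (rule real_distribution_interval_measure[OF F_mono F_right F_bot F_top])
  have cdf: "cdf (interval_measure F) = F"
    by (rule cdf_interval_measure[OF F_mono F_right F_bot])
  show thesis
  proof
    show "real_distribution (interval_measure F)" by unfold_locales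
    show "measure (interval_measure F) {a} = 0" for a
      using F_cont[of a] isCont_cdf[of a] by (simp add: cdf)
    show "char (interval_measure F) (of_int t) = of_real (b t)" for t
    proof (rule has_RS_integral_unique)
      show "has_RS_integral (\<lambda>\<theta>. exp (\<i> * of_int t * of_real \<theta>)) F (-pi) pi (char (interval_measure F) (of_int t))"
        using has_RS_integral_cdf_char[of "-pi" pi t] by (simp add: cdf F_left F_right_end)
      show "has_RS_integral (\<lambda>\<theta>. exp (\<i> * of_int t * of_real \<theta>)) F (-pi) pi (of_real (b t))"
        by (rule has_RS_integral_shift[OF _ RS, where c = "\<sigma> (-pi)"]) (simp add: F_def)
    qed
  qed
qed

text \<open>Without atoms every point is a continuity point of the limit measure. So all of the
  information on its distribution function is available: the end points carry no mass, all mass lies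
  between them, and the symmetry holds everywhere.\<close>

lemma (in correlation_sequence) continuous_spectral_distribution:
  assumes lim: "(\<lambda>N. hilbert_schmidt_norm (correlation_mat b N) / real N) \<longlonglongrightarrow> 0"
  shows "\<exists>\<sigma>. spectral_distribution b \<sigma> \<and> continuous_on {-pi..pi} \<sigma>"
proof (rule herglotz)
  fix \<mu>
  assume \<mu>: "real_distribution \<mu>" and char: "\<And>t. char \<mu> (of_int t) = of_real (b t)"
    and out: "\<And>x. x \<le> -pi \<Longrightarrow> isCont (cdf \<mu>) x \<Longrightarrow> cdf \<mu> x = 0"
    and sym: "\<And>x. isCont (cdf \<mu>) x \<Longrightarrow> isCont (cdf \<mu>) (- x) \<Longrightarrow> cdf \<mu> x + cdf \<mu> (- x) = 1"
  interpret real_distribution \<mu> by (rule \<mu>)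
  have cont: "isCont (cdf \<mu>) x" for x
    unfolding isCont_cdf by (rule hilbert_schmidt_norm_tendsto_imp_atomless[OF \<mu> char lim])
  have 0: "cdf \<mu> (-pi) = 0" using out cont by simp
  have 1: "cdf \<mu> pi = 1" using sym[of pi] cont 0 by simp
  have "spectral_distribution b (cdf \<mu>)"
    unfolding spectral_distribution_def
  proof (intro conjI allI impI)
    show "mono_on {-pi..pi} (cdf \<mu>)"
      by (intro mono_onI cdf_nondecreasing)
    show "bounded (cdf \<mu> ` {-pi..pi})"
      by (rule boundedI[of _ 1]) (auto simp: cdf_nonneg cdf_bounded_prob)
    show "has_RS_integral (\<lambda>\<theta>. exp (\<i> * of_int t * of_real \<theta>)) (cdf \<mu>) (-pi) pi (of_real (b t))" for t
      unfolding char[symmetric] using 0 1 by (intro has_RS_integral_cdf_char) auto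
    show "cdf \<mu> \<theta>2 - cdf \<mu> \<theta>1 = cdf \<mu> (-\<theta>1) - cdf \<mu> (-\<theta>2)" for \<theta>1 \<theta>2
      using sym[OF cont cont, of \<theta>1] sym[OF cont cont, of \<theta>2] by simp
  qed (simp_all add: 0 1 zero)
  moreover have "continuous_on {-pi..pi} (cdf \<mu>)"
    using cont by (simp add: continuous_at_imp_continuous_on)
  ultimately show ?thesis by blast
qed

theorem theorem2p1:
  fixes M :: "'a measure" and \<xi> :: "int \<Rightarrow> 'a \<Rightarrow> real"
  assumes "stationary_process M \<xi>"
    and "\<And>t. prob_space.expectation M (\<xi> t) = 0"
    and "\<And>t. prob_space.expectation M (\<lambda>\<omega>. (\<xi> t \<omega>)\<^sup>2) = 1"
  shows "stable_process M \<xi> \<longleftrightarrow>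
    (\<lambda>N. hilbert_schmidt_norm (correlation_mat (correlation M \<xi>) N) / real N) \<longlonglongrightarrow> 0"
proof
  assume "stable_process M \<xi>"
  then obtain \<sigma> where "spectral_distribution (correlation M \<xi>) \<sigma>" "continuous_on {-pi..pi} \<sigma>"
    unfolding stable_process_def by blast
  then obtain \<mu> where "real_distribution \<mu>" "\<And>t. char \<mu> (of_int t) = of_real (correlation M \<xi> t)"
      "\<And>a. measure \<mu> {a} = 0"
    by (rule spectral_distribution_continuousE) blast
  then show "(\<lambda>N. hilbert_schmidt_norm (correlation_mat (correlation M \<xi>) N) / real N) \<longlonglongrightarrow> 0"
    by (rule atomless_imp_hilbert_schmidt_norm_tendsto)
next
  assume lim: "(\<lambda>N. hilbert_schmidt_norm (correlation_mat (correlation M \<xi>) N) / real N) \<longlonglongrightarrow> 0"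
  interpret correlation_sequence "correlation M \<xi>"
    by (rule stationary_process_correlation_sequence[OF assms(1) assms(3)])
  show "stable_process M \<xi>"
    unfolding stable_process_def using lim by (rule continuous_spectral_distribution)
qed

end
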